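(* Suppose that $f:\mathbb{R}^n\to\mathbb{R}$ is a smooth function that is bounded below and whose gradient $g=\nabla f$ satisfies, for some constant $M>0$, $\|g(x)-g(y)\|\le M\|x-y\|$ for all $x,y\in\mathbb{R}^n$. Let $\{x_k\}$ be the sequence of iterates generated by the Inexact Successive Quadratic Approximation method described in the context, and suppose that there exist constants $0<\lambda\le\Lambda$ such that the sequence $\{H_k\}$ satisfies $\lambda_{\min}(H_k)\ge\lambda>0$ and $\lambda_{\max}(H_k)\le\Lambda$ for all $k$. Then $$\lim_{k\to\infty}F(x_k)=0 .$$
   Context: Let $\mu>0$ be a fixed regularization parameter, $\phi(x)=f(x)+\mu\|x\|_1$ and $g=\nabla f$. $\lambda_{\min}(H)$ and $\lambda_{\max}(H)$ denote the smallest and largest eigenvalues of $H$. $\|\cdot\|$ denotes any vector norm. $P_{[-\mu,\mu]}$ denotes the componentwise projection of a vector in $\mathbb{R}^n$ onto the interval $[-\mu,\mu]$. For a constant $\tau$ with $0<\tau<1$, define $$F(x)=g(x)-P_{[-\mu,\mu]}\big(g(x)-x/\tau\big),$$ $$q_k(x)=f(x_k)+g(x_k)^T(x-x_k)+\tfrac12(x-x_k)^TH_k(x-x_k)+\mu\|x\|_1,$$ $$F_q(x_k;x)=g(x_k)+H_k(x-x_k)-P_{[-\mu,\mu]}\big(g(x_k)+H_k(x-x_k)-x/\tau\big),$$ $$\ell_k(x)=f(x_k)+g(x_k)^T(x-x_k)+\mu\|x\|_1 .$$ Note that $F_q(x_k;x_k)=F(x_k)$, and that $F(x)=0$ is equivalent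 to the standard necessary optimality conditions for minimizing $\phi$. Inexact Successive Quadratic Approximation method for $\min_{x\in\mathbb{R}^n}\phi(x)$: choose an initial iterate $x_0$ and constants $\theta\in(0,1/2)$ and $0<\tau<1$; the parameters $\eta_k$ satisfy $\eta_k\in[0,1)$. For $k=0,1,\dots$, until the optimality conditions for minimizing $\phi$ are satisfied: 1. Compute (or update) the model Hessian $H_k\succ0$ (the Hessian $\nabla^2f(x_k)$ or an approximation to it) and form the piecewise quadratic model $q_k$. 2. Compute an inexact minimizer $\hat x$ of $q_k$ satisfying $\|F_q(x_k;\hat x)\|\le\eta_k\|F_q(x_k;x_k)\|$ and $q_k(\hat x)<q_k(x_k)$. 3. Perform a backtracking line search along the direction $d=\hat x-x_k$: starting with $\alpha=1$, find $\alpha\in(0,1]$ such that $\phi(x_k)-\phi(x_k+\alpha d)\ge\theta\big(\ell_k(x_k)-\ell_k(x_k+\alpha d)\big)$. 4. Set $x_{k+1}=x_k+\alpha d$.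
   Formalization: The parameters η_k∈[0,1) are assumed bounded away from 1 (sup η_k<1), without which the claim is false; the backtracking line search reduces α by factors in [β,1) for a fixed β∈(0,1), since arbitrarily short accepted steps would also break the claim. *)

theory Defs
  imports "HOL-Analysis.Analysis"
begin

definition vector_norm :: "(real^'n \<Rightarrow> real) \<Rightarrow> bool" where
  "vector_norm N \<longleftrightarrow>
     (\<forall>x. N x = 0 \<longleftrightarrow> x = 0) \<and>
     (\<forall>c x. N (c *\<^sub>R x) = \<bar>c\<bar> * N x) \<and>
     (\<forall>x y. N (x + y) \<le> N x + N y)"

definition l1_norm :: "real^'n \<Rightarrow> real" where
  "l1_norm x = (\<Sum>i\<in>UNIV. \<bar>x $ i\<bar>)"

definition pos_def :: "real^'n^'n \<Rightarrow> bool" where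
  "pos_def H \<longleftrightarrow> transpose H = H \<and> (\<forall>v. v \<noteq> 0 \<longrightarrow> v \<bullet> (H *v v) > 0)"

definition eigenvalues :: "real^'n^'n \<Rightarrow> real set" where
  "eigenvalues H = {c. \<exists>v. v \<noteq> 0 \<and> H *v v = c *\<^sub>R v}"

(* Used for symmetric H only, whose set of eigenvalues is finite and nonempty. *)
definition lambda_min :: "real^'n^'n \<Rightarrow> real" where
  "lambda_min H = Min (eigenvalues H)"

definition lambda_max :: "real^'n^'n \<Rightarrow> real" where
  "lambda_max H = Max (eigenvalues H)"

definition proj_box :: "real \<Rightarrow> real^'n \<Rightarrow> real^'n" where
  "proj_box \<mu> v = (\<chi> i. closest_point {- \<mu>..\<mu>} (v $ i))"

definition phi :: "real \<Rightarrow> (real^'n \<Rightarrow> real) \<Rightarrow> real^'n \<Rightarrow> real" where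
  "phi \<mu> f x = f x + \<mu> * l1_norm x"

definition F_res :: "real \<Rightarrow> real \<Rightarrow> (real^'n \<Rightarrow> real^'n) \<Rightarrow> real^'n \<Rightarrow> real^'n" where
  "F_res \<mu> \<tau> g x = g x - proj_box \<mu> (g x - x /\<^sub>R \<tau>)"

(* In the three model functions below, y stands for the current iterate and H for its
   model Hessian. *)
definition q_model ::
  "real \<Rightarrow> (real^'n \<Rightarrow> real) \<Rightarrow> (real^'n \<Rightarrow> real^'n) \<Rightarrow> real^'n \<Rightarrow> real^'n^'n \<Rightarrow> real^'n \<Rightarrow> real" where
  "q_model \<mu> f g y H x =
     f y + g y \<bullet> (x - y) + 1/2 * ((x - y) \<bullet> (H *v (x - y))) + \<mu> * l1_norm x"

definition Fq_res ::
  "real \<Rightarrow> real \<Rightarrow> (real^'n \<Rightarrow> real^'n) \<Rightarrow> real^'n \<Rightarrow> real^'n^'n \<Rightarrow> real^'n \<Rightarrow> real^'n" where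
  "Fq_res \<mu> \<tau> g y H x =
     g y + H *v (x - y) - proj_box \<mu> (g y + H *v (x - y) - x /\<^sub>R \<tau>)"

definition l_model ::
  "real \<Rightarrow> (real^'n \<Rightarrow> real) \<Rightarrow> (real^'n \<Rightarrow> real^'n) \<Rightarrow> real^'n \<Rightarrow> real^'n \<Rightarrow> real" where
  "l_model \<mu> f g y x = f y + g y \<bullet> (x - y) + \<mu> * l1_norm x"

definition optimality_conditions :: "real \<Rightarrow> (real^'n \<Rightarrow> real^'n) \<Rightarrow> real^'n \<Rightarrow> bool" where
  "optimality_conditions \<mu> g x \<longleftrightarrow>
     (\<forall>i. (x $ i > 0 \<longrightarrow> g x $ i + \<mu> = 0) \<and>
          (x $ i < 0 \<longrightarrow> g x $ i - \<mu> = 0) \<and>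
          (x $ i = 0 \<longrightarrow> - \<mu> \<le> g x $ i \<and> g x $ i \<le> \<mu>))"

definition inexact_minimizer ::
  "(real^'n \<Rightarrow> real) \<Rightarrow> real \<Rightarrow> real \<Rightarrow> real \<Rightarrow> (real^'n \<Rightarrow> real) \<Rightarrow> (real^'n \<Rightarrow> real^'n)
     \<Rightarrow> real^'n \<Rightarrow> real^'n^'n \<Rightarrow> real^'n \<Rightarrow> bool" where
  "inexact_minimizer N \<mu> \<tau> \<eta> f g y H z \<longleftrightarrow>
     N (Fq_res \<mu> \<tau> g y H z) \<le> \<eta> * N (Fq_res \<mu> \<tau> g y H y) \<and>
     q_model \<mu> f g y H z < q_model \<mu> f g y H y"

definition sufficient_decrease ::
  "real \<Rightarrow> real \<Rightarrow> (real^'n \<Rightarrow> real) \<Rightarrow> (real^'n \<Rightarrow> real^'n) \<Rightarrow> real^'n \<Rightarrow> real^'n \<Rightarrow> real \<Rightarrow> bool" where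
  "sufficient_decrease \<mu> \<theta> f g y d \<alpha> \<longleftrightarrow>
     phi \<mu> f y - phi \<mu> f (y + \<alpha> *\<^sub>R d) \<ge>
       \<theta> * (l_model \<mu> f g y y - l_model \<mu> f g y (y + \<alpha> *\<^sub>R d))"

(* The trial step lengths t 0 = 1 > t 1 > t 2 > ... are tested in order and the first
   acceptable one is taken.  Every reduction factor is only required to lie in [\<beta>, 1) for
   some fixed \<beta> in (0, 1), which includes the usual t i = \<beta> ^ i; without the lower bound
   on the factors the steps could become arbitrarily short. *)
definition backtracking ::
  "real \<Rightarrow> real \<Rightarrow> real \<Rightarrow> (real^'n \<Rightarrow> real) \<Rightarrow> (real^'n \<Rightarrow> real^'n)
     \<Rightarrow> real^'n \<Rightarrow> real^'n \<Rightarrow> real \<Rightarrow> bool" where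
  "backtracking \<beta> \<mu> \<theta> f g y d \<alpha> \<longleftrightarrow>
     (\<exists>(t::nat \<Rightarrow> real) j.
        t 0 = 1 \<and>
        (\<forall>i<j. \<beta> * t i \<le> t (Suc i) \<and> t (Suc i) < t i) \<and>
        (\<forall>i<j. \<not> sufficient_decrease \<mu> \<theta> f g y d (t i)) \<and>
        sufficient_decrease \<mu> \<theta> f g y d (t j) \<and>
        \<alpha> = t j)"

definition isqa_step ::
  "(real^'n \<Rightarrow> real) \<Rightarrow> real \<Rightarrow> real \<Rightarrow> real \<Rightarrow> real \<Rightarrow> real \<Rightarrow> (real^'n \<Rightarrow> real) \<Rightarrow> (real^'n \<Rightarrow> real^'n)
     \<Rightarrow> real^'n^'n \<Rightarrow> real^'n \<Rightarrow> real^'n \<Rightarrow> bool" where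
  "isqa_step N \<mu> \<tau> \<theta> \<beta> \<eta> f g H y y' \<longleftrightarrow>
     pos_def H \<and>
     (\<exists>z \<alpha>. inexact_minimizer N \<mu> \<tau> \<eta> f g y H z \<and>
            backtracking \<beta> \<mu> \<theta> f g y (z - y) \<alpha> \<and>
            y' = y + \<alpha> *\<^sub>R (z - y))"

(* A run that stops at an iterate satisfying the optimality conditions is continued by
   repeating that iterate, so that x is always an infinite sequence. *)
definition isqa_iterates ::
  "(real^'n \<Rightarrow> real) \<Rightarrow> real \<Rightarrow> real \<Rightarrow> real \<Rightarrow> real \<Rightarrow> (nat \<Rightarrow> real) \<Rightarrow> (real^'n \<Rightarrow> real) \<Rightarrow> (real^'n \<Rightarrow> real^'n)
     \<Rightarrow> (nat \<Rightarrow> real^'n^'n) \<Rightarrow> (nat \<Rightarrow> real^'n) \<Rightarrow> bool" where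
  "isqa_iterates N \<mu> \<tau> \<theta> \<beta> \<eta> f g H x \<longleftrightarrow>
     (\<forall>k. if optimality_conditions \<mu> g (x k) then x (Suc k) = x k
          else isqa_step N \<mu> \<tau> \<theta> \<beta> (\<eta> k) f g (H k) (x k) (x (Suc k)))"

lemma Fq_res_self: "Fq_res \<mu> \<tau> g y H y = F_res \<mu> \<tau> g y"
  by (simp add: Fq_res_def F_res_def)

lemma closest_point_interval:
  fixes \<mu> a :: real
  assumes "\<mu> > 0"
  shows "closest_point {- \<mu>..\<mu>} a = max (- \<mu>) (min \<mu> a)"
proof (rule closest_point_unique[symmetric])
  show "\<forall>z\<in>{- \<mu>..\<mu>}. dist a (max (- \<mu>) (min \<mu> a)) \<le> dist a z"
    using assms by (auto simp: dist_real_def max_def min_def)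
qed (use assms in auto)

lemma F_res_eq_0_iff:
  assumes "\<mu> > 0" "\<tau> > 0"
  shows "F_res \<mu> \<tau> g x = 0 \<longleftrightarrow> optimality_conditions \<mu> g x"
proof -
  have "a - max (- \<mu>) (min \<mu> (a - b / \<tau>)) = 0 \<longleftrightarrow>
        (b > 0 \<longrightarrow> a + \<mu> = 0) \<and> (b < 0 \<longrightarrow> a - \<mu> = 0) \<and> (b = 0 \<longrightarrow> - \<mu> \<le> a \<and> a \<le> \<mu>)"
    for a b :: real
  proof -
    have "b / \<tau> > 0 \<longleftrightarrow> b > 0" "b / \<tau> < 0 \<longleftrightarrow> b < 0" "b / \<tau> = 0 \<longleftrightarrow> b = 0"
      using assms by (auto simp: field_simps)
    then show ?thesis
      using assms(1) unfolding max_def min_def by (smt (verit))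
  qed
  then show ?thesis
    by (simp add: F_res_def proj_box_def optimality_conditions_def vec_eq_iff
        closest_point_interval assms divide_inverse_commute)
qed

end

theory Submission
  imports Defs
begin

text \<open>
  The objective \<open>\<phi> = f + \<mu> \<parallel>\<cdot>\<parallel>\<^sub>1\<close> drops in every iteration by at least a fixed positive multiple
  of the squared residual \<open>N (F x\<^sub>k)\<^sup>2\<close>. As \<open>\<phi>\<close> is bounded below, the drops tend to zero, and so do
  the residuals.

  Let \<open>d\<close> be the search direction. Both halves of the decrease estimate compare a quantity with
  \<open>\<parallel>d\<parallel>\<close>.

  \<^item> The drop is at least of order \<open>\<parallel>d\<parallel>\<^sup>2\<close>. Since the inexact minimizer improves on the quadratic
    model, the piecewise linear model decreases along \<open>d\<close> by at least
    \<open>d \<bullet> H d / 2 \<ge> lam \<parallel>d\<parallel>\<^sup>2 / 2\<close>, and by convexity by the fraction \<open>\<alpha>\<close> of this for a step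
    \<open>\<alpha> \<le> 1\<close>. The model differs from \<open>\<phi>\<close> by \<open>O(\<alpha>\<^sup>2 \<parallel>d\<parallel>\<^sup>2)\<close> because the gradient is Lipschitz, so
    every sufficiently short step is acceptable (\<open>short_step_acceptable\<close>) and backtracking cannot
    return a step below a fixed threshold (\<open>backtracking_bounds\<close>).

  \<^item> The residual is at most of order \<open>\<parallel>d\<parallel>\<close>. The residual of the quadratic subproblem is Lipschitz
    in its argument, with a constant governed by \<open>Lam\<close> and \<open>\<tau>\<close>, and the inexactness condition
    forces it to shrink by a factor bounded away from one over the displacement \<open>d\<close>
    (\<open>inexact_residual_bound\<close>).

  Two pieces of linear algebra translate the hypotheses into Euclidean estimates: an arbitrary norm
  is equivalent to the Euclidean one, and the extreme eigenvalues of a symmetric matrix bound its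
  quadratic form (\<open>symmetric_eigenvalue_min\<close>).
\<close>

section \<open>Equivalence of norms\<close>

lemma vector_norm_zero: "vector_norm N \<Longrightarrow> N 0 = 0"
  unfolding vector_norm_def by blast

lemma vector_norm_nonneg:
  assumes "vector_norm N"
  shows "0 \<le> N x"
proof -
  have "N (x + (-1) *\<^sub>R x) \<le> N x + N ((-1) *\<^sub>R x)" "N ((-1) *\<^sub>R x) = \<bar>-1\<bar> * N x" "N 0 = 0"
    using assms unfolding vector_norm_def by blast+
  then show ?thesis by simp
qed

lemma vector_norm_sum:
  assumes "vector_norm N" "finite S"
  shows "N (sum h S) \<le> (\<Sum>i\<in>S. N (h i))"
  using assms(2)
proof induction
  case empty
  then show ?case using assms(1) by (simp add: vector_norm_zero)
next
  case (insert a S)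
  have "N (h a + sum h S) \<le> N (h a) + N (sum h S)"
    using assms(1) unfolding vector_norm_def by blast
  with insert show ?case by simp
qed

lemma vector_norm_le_norm:
  fixes N :: "real^'n \<Rightarrow> real"
  assumes "vector_norm N"
  obtains b where "0 < b" "\<And>x. N x \<le> b * norm x"
proof
  let ?b = "\<Sum>i\<in>UNIV. N (axis i 1)"
  have nn: "0 \<le> ?b"
    by (intro sum_nonneg vector_norm_nonneg[OF assms])
  then show "0 < ?b + 1" by simp
  fix x :: "real^'n"
  have "N x = N (\<Sum>i\<in>UNIV. x $ i *\<^sub>R axis i 1)"
    by (simp add: vector_space_over_itself.scale_sum_right basis_expansion flip: scalar_mult_eq_scaleR)
  also have "\<dots> \<le> (\<Sum>i\<in>UNIV. N (x $ i *\<^sub>R axis i 1))"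
    by (rule vector_norm_sum[OF assms]) simp
  also have "\<dots> = (\<Sum>i\<in>UNIV. \<bar>x $ i\<bar> * N (axis i 1))"
    using assms by (simp add: vector_norm_def)
  also have "\<dots> \<le> (\<Sum>i\<in>UNIV. norm x * N (axis i 1))"
    by (intro sum_mono mult_right_mono component_le_norm_cart vector_norm_nonneg[OF assms])
  also have "\<dots> = ?b * norm x"
    by (simp add: sum_distrib_left mult.commute)
  also have "\<dots> \<le> (?b + 1) * norm x"
    by (simp add: algebra_simps)
  finally show "N x \<le> (?b + 1) * norm x" .
qed

text \<open>
  The lower constant is the minimum of the norm over the Euclidean unit sphere, which is attained
  because the upper estimate makes the norm continuous.
\<close>

lemma norm_le_vector_norm:
  fixes N :: "real^'n \<Rightarrow> real"
  assumes N: "vector_norm N"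
  obtains a where "0 < a" "\<And>x. a * norm x \<le> N x"
proof -
  obtain b where b: "0 < b" "\<And>x. N x \<le> b * norm x"
    using vector_norm_le_norm[OF N] by blast
  have tri: "N (x + y) \<le> N x + N y" and scale: "N (c *\<^sub>R x) = \<bar>c\<bar> * N x"
    and zero: "N x = 0 \<longleftrightarrow> x = 0" for x y c
    using N unfolding vector_norm_def by blast+
  have le: "N x - N y \<le> b * dist x y" for x y
    using tri[of "x - y" y] b(2)[of "x - y"] by (simp add: dist_norm)
  have "b-lipschitz_on UNIV N"
  proof (rule lipschitz_onI)
    show "dist (N x) (N y) \<le> b * dist x y" for x y
      using le[of x y] le[of y x] by (simp add: dist_real_def dist_commute abs_le_iff)
  qed (use b in simp)
  then have cont: "continuous_on (sphere 0 1) N"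
    using lipschitz_on_continuous_on continuous_on_subset by blast
  have "sphere (0::real^'n) 1 \<noteq> {}" by simp
  then obtain u where u: "u \<in> sphere 0 1" "\<And>v. v \<in> sphere 0 1 \<Longrightarrow> N u \<le> N v"
    using continuous_attains_inf[OF compact_sphere _ cont] by blast
  show thesis
  proof
    have "u \<noteq> 0" using u(1) by auto
    then show "0 < N u"
      using vector_norm_nonneg[OF N, of u] zero[of u] by simp
    show "N u * norm x \<le> N x" for x
    proof (cases "x = 0")
      case False
      then have "N u \<le> N (inverse (norm x) *\<^sub>R x)"
        by (intro u(2)) simp
      with False show ?thesis
        by (simp add: scale field_simps)
    qed (simp add: vector_norm_zero[OF N])
  qed
qed

section \<open>Symmetric matrices and their extreme eigenvalues\<close>

lemma symmetric_matrix_inner: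
  fixes A :: "real^'n^'n"
  assumes "transpose A = A"
  shows "u \<bullet> (A *v v) = (A *v u) \<bullet> v"
  using dot_lmul_matrix[of u A v] assms by (metis transpose_matrix_vector)

text \<open>
  The form is nonnegative at \<open>v - A v / K\<close>. Expanding it there, the cross term is
  \<open>- 2 \<parallel>A v\<parallel>\<^sup>2 / K\<close> and the upper bound on the form turns the last term into at most
  \<open>\<parallel>A v\<parallel>\<^sup>2 / K\<close>. The estimate serves two purposes: it bounds \<open>\<parallel>A v\<parallel>\<close>, and it shows that
  \<open>A v = 0\<close> wherever the form vanishes.
\<close>

lemma psd_norm_square_le:
  fixes A :: "real^'n^'n"
  assumes sym: "transpose A = A" and psd: "\<And>u. 0 \<le> u \<bullet> (A *v u)"
    and K: "0 < K" "\<And>u. u \<bullet> (A *v u) \<le> K * (norm u)\<^sup>2"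
  shows "(norm (A *v v))\<^sup>2 \<le> K * (v \<bullet> (A *v v))"
proof -
  define w where "w = A *v v"
  define t where "t = 1 / K"
  have tK: "t * K = 1" "0 < t" using K(1) by (simp_all add: t_def)
  have vw: "v \<bullet> (A *v w) = (norm w)\<^sup>2"
    using symmetric_matrix_inner[OF sym, of v w] by (simp add: w_def power2_norm_eq_inner)
  have "0 \<le> (v - t *\<^sub>R w) \<bullet> (A *v (v - t *\<^sub>R w))"
    by (rule psd)
  also have "\<dots> = v \<bullet> w - 2 * t * (norm w)\<^sup>2 + t * (t * (w \<bullet> (A *v w)))"
    using vw by (simp add: matrix_vector_mult_diff_distrib matrix_vector_mult_scaleR inner_diff
        power2_norm_eq_inner inner_commute algebra_simps flip: w_def)
  also have "t * (t * (w \<bullet> (A *v w))) \<le> t * (t * (K * (norm w)\<^sup>2))"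
    using tK K by (intro mult_left_mono) auto
  also have "\<dots> = t * (norm w)\<^sup>2"
    using tK by (simp flip: mult.assoc)
  finally have "t * (norm w)\<^sup>2 \<le> v \<bullet> w" by simp
  then have "K * (t * (norm w)\<^sup>2) \<le> K * (v \<bullet> w)"
    using K(1) by simp
  then show ?thesis
    using tK by (simp add: w_def mult.commute flip: mult.assoc)
qed

text \<open>
  The minimum \<open>m\<close> of the quadratic form over the unit sphere is an eigenvalue: the shifted matrix
  \<open>A - m I\<close> is positive semidefinite and its form vanishes at the minimizer, which is therefore in
  its kernel.
\<close>

lemma symmetric_eigenvalue_min:
  fixes A :: "real^'n^'n"
  assumes sym: "transpose A = A"
  obtains m where "m \<in> eigenvalues A" "\<And>u. m * (norm u)\<^sup>2 \<le> u \<bullet> (A *v u)"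
proof -
  have "sphere (0::real^'n) 1 \<noteq> {}" by simp
  moreover have "continuous_on (sphere 0 1) (\<lambda>u. u \<bullet> (A *v u))"
    by (intro continuous_intros linear_continuous_on matrix_vector_mul_bounded_linear)
  ultimately obtain v where v: "v \<in> sphere 0 1"
      "\<And>u. u \<in> sphere 0 1 \<Longrightarrow> v \<bullet> (A *v v) \<le> u \<bullet> (A *v u)"
    using continuous_attains_inf[OF compact_sphere] by blast
  define m where "m = v \<bullet> (A *v v)"
  have low: "m * (norm u)\<^sup>2 \<le> u \<bullet> (A *v u)" for u
  proof (cases "u = 0")
    case False
    then have "m \<le> (inverse (norm u) *\<^sub>R u) \<bullet> (A *v (inverse (norm u) *\<^sub>R u))"
      unfolding m_def by (intro v(2)) simp
    also have "\<dots> = (u \<bullet> (A *v u)) / (norm u)\<^sup>2"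
      by (simp add: matrix_vector_mult_scaleR power2_eq_square divide_inverse)
    finally show ?thesis
      using False by (simp add: field_simps)
  qed simp
  define B where "B = A - m *\<^sub>R mat 1"
  have B: "B *v u = A *v u - m *\<^sub>R u" for u
    by (simp add: B_def matrix_vector_mult_diff_rdistrib flip: scaleR_matrix_vector_assoc)
  have Bform: "u \<bullet> (B *v u) = u \<bullet> (A *v u) - m * (norm u)\<^sup>2" for u
    by (simp add: B inner_diff_right power2_norm_eq_inner)
  obtain K where K: "0 < K" "\<And>u. norm (B *v u) \<le> norm u * K"
    using bounded_linear.pos_bounded[OF matrix_vector_mul_bounded_linear[of B]] by blast
  have "(norm (B *v v))\<^sup>2 \<le> K * (v \<bullet> (B *v v))"
  proof (rule psd_norm_square_le[OF _ _ K(1)])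
    show "transpose B = B"
      using sym by (simp add: B_def transpose_def mat_def vec_eq_iff)
    show "0 \<le> u \<bullet> (B *v u)" for u
      using low[of u] by (simp add: Bform)
    show "u \<bullet> (B *v u) \<le> K * (norm u)\<^sup>2" for u
    proof -
      have "u \<bullet> (B *v u) \<le> norm u * norm (B *v u)"
        by (rule norm_cauchy_schwarz)
      also have "\<dots> \<le> norm u * (norm u * K)"
        by (intro mult_left_mono K) simp
      finally show ?thesis by (simp add: power2_eq_square mult.commute mult.left_commute)
    qed
  qed
  also have "v \<bullet> (B *v v) = 0"
    using v(1) by (simp add: Bform m_def)
  finally have "A *v v = m *\<^sub>R v"
    by (simp add: B)
  moreover have "v \<noteq> 0" using v(1) by auto
  ultimately have "m \<in> eigenvalues A"
    by (auto simp: eigenvalues_def)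
  with low show thesis using that by blast
qed

text \<open>
  Eigenvectors of a symmetric matrix for distinct eigenvalues are orthogonal, and a finite-dimensional
  space has no infinite orthogonal set of nonzero vectors.
\<close>

lemma finite_eigenvalues_symmetric:
  fixes A :: "real^'n^'n"
  assumes sym: "transpose A = A"
  shows "finite (eigenvalues A)"
proof -
  define e where "e c = (SOME v. v \<noteq> 0 \<and> A *v v = c *\<^sub>R v)" for c
  have e: "e c \<noteq> 0" "A *v e c = c *\<^sub>R e c" if "c \<in> eigenvalues A" for c
    using that someI_ex[of "\<lambda>v. v \<noteq> 0 \<and> A *v v = c *\<^sub>R v"]
    unfolding e_def eigenvalues_def by blast+
  have orth: "e c \<bullet> e c' = 0" if "c \<in> eigenvalues A" "c' \<in> eigenvalues A" "c \<noteq> c'" for c c'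
    using symmetric_matrix_inner[OF sym, of "e c" "e c'"] that by (simp add: e)
  have inj: "inj_on e (eigenvalues A)"
  proof (rule inj_onI, rule ccontr)
    fix c c' assume "c \<in> eigenvalues A" "c' \<in> eigenvalues A" "e c = e c'" "c \<noteq> c'"
    then show False using orth[of c c'] e(1)[of c] by simp
  qed
  have "pairwise orthogonal (e ` eigenvalues A)"
    unfolding pairwise_def orthogonal_def using orth by blast
  moreover have "0 \<notin> e ` eigenvalues A"
    using e(1) by auto
  ultimately have "independent (e ` eigenvalues A)"
    by (rule pairwise_orthogonal_independent)
  then have "finite (e ` eigenvalues A)"
    by (rule independent_imp_finite)
  then show ?thesis
    using inj finite_imageD by blast
qed

lemma lambda_min_form_le:
  fixes A :: "real^'n^'n"
  assumes sym: "transpose A = A"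
  shows "lambda_min A * (norm u)\<^sup>2 \<le> u \<bullet> (A *v u)"
proof -
  obtain m where m: "m \<in> eigenvalues A" "\<And>u. m * (norm u)\<^sup>2 \<le> u \<bullet> (A *v u)"
    using symmetric_eigenvalue_min[OF sym] by blast
  have "lambda_min A \<le> m"
    unfolding lambda_min_def by (rule Min_le[OF finite_eigenvalues_symmetric[OF sym] m(1)])
  then have "lambda_min A * (norm u)\<^sup>2 \<le> m * (norm u)\<^sup>2"
    by (rule mult_right_mono) simp
  with m(2)[of u] show ?thesis by linarith
qed

lemma form_le_lambda_max:
  fixes A :: "real^'n^'n"
  assumes sym: "transpose A = A"
  shows "u \<bullet> (A *v u) \<le> lambda_max A * (norm u)\<^sup>2"
proof -
  have neg: "(- A) *v v = - (A *v v)" for v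
    using matrix_vector_mult_diff_rdistrib[of 0 A v] by simp
  have "transpose (- A) = - A"
    using sym by (simp add: transpose_def vec_eq_iff)
  then obtain m where m: "m \<in> eigenvalues (- A)" "\<And>u. m * (norm u)\<^sup>2 \<le> u \<bullet> ((- A) *v u)"
    using symmetric_eigenvalue_min by blast
  from m(1) have "- m \<in> eigenvalues A"
    unfolding eigenvalues_def neg by (auto simp: minus_equation_iff[of "A *v _"])
  then have "- m \<le> lambda_max A"
    unfolding lambda_max_def by (rule Max_ge[OF finite_eigenvalues_symmetric[OF sym]])
  then have "- m * (norm u)\<^sup>2 \<le> lambda_max A * (norm u)\<^sup>2"
    by (rule mult_right_mono) simp
  with m(2)[of u] show ?thesis by (simp add: neg)
qed

section \<open>Descent along the search direction\<close>

text \<open>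
  Along the segment from \<open>y\<close> to \<open>y + s\<close>, the difference of the two sides has a derivative of
  constant sign, because the gradient moves by at most \<open>t L \<parallel>s\<parallel>\<close> over the portion \<open>t\<close>.
\<close>

lemma lipschitz_gradient_upper_bound:
  fixes f :: "'a::real_inner \<Rightarrow> real"
  assumes grad: "\<And>y. GDERIV f y :> g y"
    and lip: "\<And>y z. norm (g y - g z) \<le> L * norm (y - z)"
  shows "f (y + s) \<le> f y + g y \<bullet> s + L / 2 * (norm s)\<^sup>2"
proof -
  define h where "h t = f (y + t *\<^sub>R s) - t * (g y \<bullet> s) - L / 2 * (norm s)\<^sup>2 * t\<^sup>2" for t
  have "h 1 \<le> h 0"
  proof (rule DERIV_nonpos_imp_nonincreasing[where f = h])
    fix t :: real assume t: "0 \<le> t" "t \<le> 1"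
    have "(f has_derivative (\<lambda>v. v \<bullet> g (y + t *\<^sub>R s))) (at (y + t *\<^sub>R s))"
      using grad[of "y + t *\<^sub>R s"] by (simp add: gderiv_def)
    then have "((\<lambda>t. f (y + t *\<^sub>R s)) has_derivative (\<lambda>r. (r *\<^sub>R s) \<bullet> g (y + t *\<^sub>R s))) (at t)"
      by (rule has_derivative_compose[rotated]) (auto intro!: derivative_eq_intros)
    then have 1: "((\<lambda>t. f (y + t *\<^sub>R s)) has_real_derivative (s \<bullet> g (y + t *\<^sub>R s))) (at t)"
      by (simp add: has_field_derivative_def mult_commute_abs)
    have 2: "(h has_real_derivative
        (s \<bullet> g (y + t *\<^sub>R s) - g y \<bullet> s - L / 2 * (norm s)\<^sup>2 * (2 * t))) (at t)"
      unfolding h_def by (auto intro!: derivative_eq_intros 1)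
    have "s \<bullet> g (y + t *\<^sub>R s) - g y \<bullet> s = s \<bullet> (g (y + t *\<^sub>R s) - g y)"
      by (simp add: inner_diff_right inner_commute)
    also have "\<dots> \<le> norm s * norm (g (y + t *\<^sub>R s) - g y)"
      by (rule norm_cauchy_schwarz)
    also have "\<dots> \<le> norm s * (L * norm (t *\<^sub>R s))"
      using lip[of "y + t *\<^sub>R s" y] by (intro mult_left_mono) auto
    also have "\<dots> = L / 2 * (norm s)\<^sup>2 * (2 * t)"
      using t by (simp add: power2_eq_square)
    finally show "\<exists>D. (h has_real_derivative D) (at t) \<and> D \<le> 0"
      using 2 by (intro exI conjI) auto
  qed simp
  then show ?thesis by (simp add: h_def)
qed

lemma l1_norm_nonneg: "0 \<le> l1_norm x"
  by (simp add: l1_norm_def sum_nonneg)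

lemma l1_norm_segment:
  assumes "0 \<le> a" "a \<le> 1"
  shows "l1_norm (y + a *\<^sub>R d) \<le> (1 - a) * l1_norm y + a * l1_norm (y + d)"
proof -
  have "\<bar>y $ i + a * d $ i\<bar> \<le> (1 - a) * \<bar>y $ i\<bar> + a * \<bar>y $ i + d $ i\<bar>" for i
  proof -
    have "y $ i + a * d $ i = (1 - a) * y $ i + a * (y $ i + d $ i)"
      by (simp add: algebra_simps)
    also have "\<bar>\<dots>\<bar> \<le> \<bar>(1 - a) * y $ i\<bar> + \<bar>a * (y $ i + d $ i)\<bar>"
      by (rule abs_triangle_ineq)
    finally show ?thesis using assms by (simp add: abs_mult)
  qed
  then show ?thesis
    unfolding l1_norm_def sum_distrib_left sum.distrib[symmetric] by (intro sum_mono) simp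
qed

text \<open>
  A decrease of the quadratic model makes up for its own curvature term, so the piecewise linear
  model decreases by at least that term; convexity carries this over to shorter steps.
\<close>

lemma l_model_decrease:
  assumes \<mu>: "0 < \<mu>"
    and form: "\<And>u. lam * (norm u)\<^sup>2 \<le> u \<bullet> (H *v u)"
    and q: "q_model \<mu> f g y H (y + d) < q_model \<mu> f g y H y"
    and a: "0 \<le> a" "a \<le> 1"
  shows "a * (lam / 2 * (norm d)\<^sup>2) \<le> l_model \<mu> f g y y - l_model \<mu> f g y (y + a *\<^sub>R d)"
proof -
  have "lam / 2 * (norm d)\<^sup>2 \<le> \<mu> * l1_norm y - g y \<bullet> d - \<mu> * l1_norm (y + d)"
    using q form[of d] by (simp add: q_model_def)
  then have "a * (lam / 2 * (norm d)\<^sup>2) \<le> a * (\<mu> * l1_norm y - g y \<bullet> d - \<mu> * l1_norm (y + d))"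
    using a by (intro mult_left_mono)
  moreover have "\<mu> * l1_norm (y + a *\<^sub>R d) \<le> \<mu> * ((1 - a) * l1_norm y + a * l1_norm (y + d))"
    using \<mu> l1_norm_segment[OF a] by simp
  ultimately show ?thesis
    by (simp add: l_model_def algebra_simps)
qed

text \<open>
  The model overestimates the decrease of the objective by at most \<open>L a\<^sup>2 \<parallel>d\<parallel>\<^sup>2 / 2\<close>. For the
  stated step lengths this is covered by the fraction \<open>1 - \<theta>\<close> of the model decrease that the
  line search allows to be lost.
\<close>

lemma short_step_acceptable:
  assumes \<mu>: "0 < \<mu>" and \<theta>: "\<theta> < 1"
    and form: "\<And>u. lam * (norm u)\<^sup>2 \<le> u \<bullet> (H *v u)"
    and grad: "\<And>y. GDERIV f y :> g y"
    and lip: "\<And>y z. norm (g y - g z) \<le> L * norm (y - z)"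
    and q: "q_model \<mu> f g y H (y + d) < q_model \<mu> f g y H y"
    and a: "0 \<le> a" "a \<le> 1" "L * a \<le> (1 - \<theta>) * lam"
  shows "sufficient_decrease \<mu> \<theta> f g y d a"
proof -
  define D where "D = l_model \<mu> f g y y - l_model \<mu> f g y (y + a *\<^sub>R d)"
  have "f (y + a *\<^sub>R d) \<le> f y + a * (g y \<bullet> d) + L / 2 * (norm (a *\<^sub>R d))\<^sup>2"
    using lipschitz_gradient_upper_bound[OF grad lip, of y "a *\<^sub>R d"] by simp
  also have "L / 2 * (norm (a *\<^sub>R d))\<^sup>2 = (L * a) * (a / 2 * (norm d)\<^sup>2)"
    using a by (simp add: power_mult_distrib power2_eq_square)
  also have "\<dots> \<le> ((1 - \<theta>) * lam) * (a / 2 * (norm d)\<^sup>2)"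
    using a by (intro mult_right_mono) auto
  also have "\<dots> = (1 - \<theta>) * (a * (lam / 2 * (norm d)\<^sup>2))"
    by simp
  also have "\<dots> \<le> (1 - \<theta>) * D"
    unfolding D_def using \<theta> l_model_decrease[OF \<mu> form q a(1,2)] by (intro mult_left_mono) auto
  finally have "f (y + a *\<^sub>R d) \<le> f y + a * (g y \<bullet> d) + (1 - \<theta>) * D" by simp
  then have "D - (1 - \<theta>) * D \<le> phi \<mu> f y - phi \<mu> f (y + a *\<^sub>R d)"
    by (simp add: phi_def D_def l_model_def)
  then show ?thesis
    unfolding sufficient_decrease_def D_def[symmetric] by (simp add: algebra_simps)
qed

text \<open>
  Either the full step is taken, or the step tried just before the accepted one was rejected; the
  rejected step exceeds \<open>c\<close>, and a single reduction shrinks it at most by the factor \<open>\<beta>\<close>.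
\<close>

lemma backtracking_bounds:
  assumes \<beta>: "0 < \<beta>"
    and short: "\<And>a. \<lbrakk>0 \<le> a; a \<le> 1; a \<le> c\<rbrakk> \<Longrightarrow> sufficient_decrease \<mu> \<theta> f g y d a"
    and bt: "backtracking \<beta> \<mu> \<theta> f g y d \<alpha>"
  shows "min 1 (\<beta> * c) \<le> \<alpha>" "0 < \<alpha>" "\<alpha> \<le> 1" "sufficient_decrease \<mu> \<theta> f g y d \<alpha>"
proof -
  obtain t :: "nat \<Rightarrow> real" and j where t: "t 0 = 1"
      "\<And>i. i < j \<Longrightarrow> \<beta> * t i \<le> t (Suc i) \<and> t (Suc i) < t i"
      "\<And>i. i < j \<Longrightarrow> \<not> sufficient_decrease \<mu> \<theta> f g y d (t i)"
      "sufficient_decrease \<mu> \<theta> f g y d (t j)" "\<alpha> = t j"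
    using bt unfolding backtracking_def by blast
  have range: "0 < t i \<and> t i \<le> 1" if "i \<le> j" for i
    using that
  proof (induction i)
    case (Suc i)
    then have "0 < \<beta> * t i" "\<beta> * t i \<le> t (Suc i)" "t (Suc i) < t i" "t i \<le> 1"
      using \<beta> t(2)[of i] by auto
    then show ?case by linarith
  qed (simp add: t(1))
  show "0 < \<alpha>" "\<alpha> \<le> 1" using range[of j] t(5) by auto
  show "sufficient_decrease \<mu> \<theta> f g y d \<alpha>" using t by simp
  show "min 1 (\<beta> * c) \<le> \<alpha>"
  proof (cases j)
    case 0
    then show ?thesis using t by simp
  next
    case (Suc i)
    then have "c < t i"
      using short[of "t i"] t(3)[of i] range[of i] by force
    then have "\<beta> * c \<le> \<beta> * t i" using \<beta> by simp
    also have "\<dots> \<le> \<alpha>" using t(2)[of i] t(5) Suc by simp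
    finally show ?thesis by simp
  qed
qed

section \<open>The residual of the quadratic subproblem\<close>

lemma proj_box_nonexpansive:
  assumes "0 < \<mu>"
  shows "norm (proj_box \<mu> u - proj_box \<mu> v) \<le> norm (u - v)"
proof (rule norm_le_componentwise_cart)
  fix i
  have "dist (closest_point {- \<mu>..\<mu>} (u $ i)) (closest_point {- \<mu>..\<mu>} (v $ i))
      \<le> dist (u $ i) (v $ i)"
    using assms by (intro closest_point_lipschitz) auto
  then show "norm ((proj_box \<mu> u - proj_box \<mu> v) $ i) \<le> norm ((u - v) $ i)"
    by (simp add: proj_box_def dist_real_def)
qed

lemma Fq_res_lipschitz:
  assumes \<mu>: "0 < \<mu>" and \<tau>: "0 < \<tau>"
    and Lam: "\<And>u. norm (H *v u) \<le> Lam * norm u"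
  shows "norm (Fq_res \<mu> \<tau> g y H (y + d) - Fq_res \<mu> \<tau> g y H y) \<le> (2 * Lam + 1 / \<tau>) * norm d"
proof -
  let ?p = "g y + H *v d - (y + d) /\<^sub>R \<tau>" and ?q = "g y - y /\<^sub>R \<tau>"
  have "norm (Fq_res \<mu> \<tau> g y H (y + d) - Fq_res \<mu> \<tau> g y H y)
      = norm (H *v d - (proj_box \<mu> ?p - proj_box \<mu> ?q))"
    by (simp add: Fq_res_def algebra_simps)
  also have "\<dots> \<le> norm (H *v d) + norm (proj_box \<mu> ?p - proj_box \<mu> ?q)"
    by (rule norm_triangle_ineq4)
  also have "norm (proj_box \<mu> ?p - proj_box \<mu> ?q) \<le> norm (?p - ?q)"
    by (rule proj_box_nonexpansive[OF \<mu>])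
  also have "?p - ?q = H *v d - d /\<^sub>R \<tau>"
    by (simp add: algebra_simps)
  also have "norm \<dots> \<le> norm (H *v d) + norm (d /\<^sub>R \<tau>)"
    by (rule norm_triangle_ineq4)
  also have "norm (d /\<^sub>R \<tau>) = 1 / \<tau> * norm d"
    using \<tau> by (simp add: divide_inverse)
  finally show ?thesis
    using Lam[of d] by (simp add: algebra_simps)
qed

text \<open>
  The triangle inequality gives \<open>N (F y) \<le> N (F\<^sub>q (y + d)) + N (F\<^sub>q y - F\<^sub>q (y + d))\<close>, where the first
  term is at most \<open>E N (F y)\<close> and can be absorbed on the left because \<open>E < 1\<close>.
\<close>

lemma inexact_residual_bound:
  assumes N: "vector_norm N" and b: "0 < b" "\<And>u. N u \<le> b * norm u"
    and \<mu>: "0 < \<mu>" and \<tau>: "0 < \<tau>"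
    and Lam: "\<And>u. norm (H *v u) \<le> Lam * norm u"
    and \<eta>: "\<eta> \<le> E"
    and z: "inexact_minimizer N \<mu> \<tau> \<eta> f g y H (y + d)"
  shows "(1 - E) * N (F_res \<mu> \<tau> g y) \<le> b * (2 * Lam + 1 / \<tau>) * norm d"
proof -
  let ?F = "Fq_res \<mu> \<tau> g y H"
  have "N (?F (y + d) + (-1) *\<^sub>R (?F (y + d) - ?F y)) \<le> N (?F (y + d)) + N ((-1) *\<^sub>R (?F (y + d) - ?F y))"
       "N ((-1) *\<^sub>R (?F (y + d) - ?F y)) = \<bar>-1\<bar> * N (?F (y + d) - ?F y)"
    using N unfolding vector_norm_def by blast+
  then have "N (?F y) \<le> N (?F (y + d)) + N (?F (y + d) - ?F y)" by simp
  moreover have "N (?F (y + d)) \<le> \<eta> * N (?F y)"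
    using z by (simp add: inexact_minimizer_def)
  moreover have "\<eta> * N (?F y) \<le> E * N (?F y)"
    by (intro mult_right_mono \<eta> vector_norm_nonneg[OF N])
  moreover have "N (?F (y + d) - ?F y) \<le> b * ((2 * Lam + 1 / \<tau>) * norm d)"
    using b(2)[of "?F (y + d) - ?F y"] Fq_res_lipschitz[where g = g and y = y and d = d, OF \<mu> \<tau> Lam] b(1)
    by (meson mult_left_mono less_imp_le order_trans)
  ultimately show ?thesis
    by (simp add: Fq_res_self algebra_simps)
qed

section \<open>Convergence\<close>

text \<open>
  The two halves of the estimate are chained through \<open>\<parallel>d\<parallel>\<close>: the constant in front of the square is
  the line search fraction times the minimal step length times half the minimal curvature, and the
  square is of the lower bound for \<open>\<parallel>d\<parallel>\<close> that the residual provides.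
\<close>

lemma isqa_step_decrease:
  fixes f :: "real^'n \<Rightarrow> real"
  assumes N: "vector_norm N" and b: "0 < b" "\<And>u. N u \<le> b * norm u"
    and \<mu>: "0 < \<mu>" and \<tau>: "0 < \<tau>" and \<theta>: "0 < \<theta>" "\<theta> < 1" and \<beta>: "0 < \<beta>"
    and \<eta>: "\<eta> \<le> E" "E < 1"
    and grad: "\<And>y. GDERIV f y :> g y"
    and L: "0 < L" "\<And>y z. norm (g y - g z) \<le> L * norm (y - z)"
    and lam: "0 < lam" "lam \<le> lambda_min H" and Lam: "0 < Lam" "lambda_max H \<le> Lam"
    and step: "isqa_step N \<mu> \<tau> \<theta> \<beta> \<eta> f g H y y'"
  shows "\<theta> * min 1 (\<beta> * ((1 - \<theta>) * lam / L)) * (lam / 2) *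
      ((1 - E) * N (F_res \<mu> \<tau> g y) / (b * (2 * Lam + 1 / \<tau>)))\<^sup>2 \<le> phi \<mu> f y - phi \<mu> f y'"
proof -
  obtain z \<alpha> where H: "pos_def H" and z: "inexact_minimizer N \<mu> \<tau> \<eta> f g y H z"
    and bt: "backtracking \<beta> \<mu> \<theta> f g y (z - y) \<alpha>" and y': "y' = y + \<alpha> *\<^sub>R (z - y)"
    using step unfolding isqa_step_def by blast
  define d where "d = z - y"
  have z_eq: "z = y + d" by (simp add: d_def)
  have sym: "transpose H = H" using H by (simp add: pos_def_def)
  have low: "lam * (norm u)\<^sup>2 \<le> u \<bullet> (H *v u)" for u
    using lambda_min_form_le[OF sym, of u] mult_right_mono[OF lam(2), of "(norm u)\<^sup>2"] by simp
  have up: "u \<bullet> (H *v u) \<le> Lam * (norm u)\<^sup>2" for u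
    using form_le_lambda_max[OF sym, of u] mult_right_mono[OF Lam(2), of "(norm u)\<^sup>2"] by simp
  have Lam_norm: "norm (H *v u) \<le> Lam * norm u" for u
  proof (rule power2_le_imp_le)
    have "(norm (H *v u))\<^sup>2 \<le> Lam * (u \<bullet> (H *v u))"
    proof (rule psd_norm_square_le[OF sym _ Lam(1) up])
      show "0 \<le> v \<bullet> (H *v v)" for v
        using low[of v] lam(1) by (smt (verit) mult_nonneg_nonneg zero_le_power2)
    qed
    also have "\<dots> \<le> Lam * (Lam * (norm u)\<^sup>2)"
      using up[of u] Lam(1) by simp
    finally show "(norm (H *v u))\<^sup>2 \<le> (Lam * norm u)\<^sup>2"
      by (simp add: power_mult_distrib power2_eq_square mult_ac)
  qed (use Lam in simp)
  have q: "q_model \<mu> f g y H (y + d) < q_model \<mu> f g y H y"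
    using z by (simp add: inexact_minimizer_def z_eq)
  define a where "a = min 1 (\<beta> * ((1 - \<theta>) * lam / L))"
  have short: "sufficient_decrease \<mu> \<theta> f g y d s"
    if "0 \<le> s" "s \<le> 1" "s \<le> (1 - \<theta>) * lam / L" for s
    using that L(1)
    by (intro short_step_acceptable[OF \<mu> \<theta>(2) low grad L(2) q]) (simp_all add: field_simps)
  note \<alpha> = backtracking_bounds[where c = "(1 - \<theta>) * lam / L",
      OF \<beta> short bt[folded d_def], folded a_def]
  define B where "B = b * (2 * Lam + 1 / \<tau>)"
  have B: "0 < B" using b Lam \<tau> by (simp add: B_def add_pos_pos)
  have nonneg: "0 \<le> (1 - E) * N (F_res \<mu> \<tau> g y)"
    using \<eta> vector_norm_nonneg[OF N] by simp
  have a_pos: "0 < a" using \<beta> \<theta> lam L by (simp add: a_def)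
  have "(1 - E) * N (F_res \<mu> \<tau> g y) / B \<le> norm d"
    using inexact_residual_bound[OF N b \<mu> \<tau> Lam_norm \<eta>(1) z[unfolded z_eq]] B
    unfolding B_def[symmetric] by (simp add: divide_le_eq mult.commute)
  then have "((1 - E) * N (F_res \<mu> \<tau> g y) / B)\<^sup>2 \<le> (norm d)\<^sup>2"
    using nonneg B by (intro power_mono) auto
  then have "\<theta> * a * (lam / 2) * ((1 - E) * N (F_res \<mu> \<tau> g y) / B)\<^sup>2
      \<le> \<theta> * a * (lam / 2) * (norm d)\<^sup>2"
    using \<theta> a_pos lam by (intro mult_left_mono) auto
  also have "\<dots> = \<theta> * (a * (lam / 2 * (norm d)\<^sup>2))" by simp
  also have "\<dots> \<le> \<theta> * (\<alpha> * (lam / 2 * (norm d)\<^sup>2))"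
    using \<theta> lam \<alpha>(1) by (intro mult_left_mono mult_right_mono) auto
  also have "\<dots> \<le> \<theta> * (l_model \<mu> f g y y - l_model \<mu> f g y (y + \<alpha> *\<^sub>R d))"
    using \<theta> \<alpha> l_model_decrease[OF \<mu> low q, of \<alpha>] by (intro mult_left_mono) auto
  also have "\<dots> \<le> phi \<mu> f y - phi \<mu> f y'"
    using \<alpha>(4) by (simp add: sufficient_decrease_def y' d_def)
  finally show ?thesis by (simp add: a_def B_def)
qed

lemma bounded_below_decrements_tendsto_0:
  fixes p :: "nat \<Rightarrow> real"
  assumes "bdd_below (range p)" "\<And>k. p (Suc k) \<le> p k"
  shows "(\<lambda>k. p k - p (Suc k)) \<longlonglongrightarrow> 0"
proof -
  have "p \<longlonglongrightarrow> (INF k. p k)"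
    using assms by (intro LIMSEQ_decseq_INF decseq_SucI)
  from tendsto_diff[OF this LIMSEQ_Suc[OF this]] show ?thesis by simp
qed

theorem theorem3p1:
  fixes f :: "real^'n \<Rightarrow> real" and g :: "real^'n \<Rightarrow> real^'n"
    and N :: "real^'n \<Rightarrow> real"
    and x :: "nat \<Rightarrow> real^'n" and H :: "nat \<Rightarrow> real^'n^'n" and \<eta> :: "nat \<Rightarrow> real"
    and \<mu> \<tau> \<theta> \<beta> M lam Lam :: real
  assumes norm: "vector_norm N"
    and \<mu>: "0 < \<mu>" and \<tau>: "0 < \<tau>" "\<tau> < 1" and \<theta>: "0 < \<theta>" "\<theta> < 1/2"
    and \<beta>: "0 < \<beta>" "\<beta> < 1"
    and \<eta>: "\<forall>k. 0 \<le> \<eta> k \<and> \<eta> k < 1" and \<eta>_sup: "(SUP k. \<eta> k) < 1"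
    and gradient: "\<forall>y. GDERIV f y :> g y"
    and bounded_below: "bdd_below (range f)"
    and M: "0 < M" and lipschitz: "\<forall>y z. N (g y - g z) \<le> M * N (y - z)"
    and iterates: "isqa_iterates N \<mu> \<tau> \<theta> \<beta> \<eta> f g H x"
    and bounds: "0 < lam" "lam \<le> Lam"
    and eigenvalue_bounds: "\<forall>k. lam \<le> lambda_min (H k) \<and> lambda_max (H k) \<le> Lam"
  shows "(\<lambda>k. F_res \<mu> \<tau> g (x k)) \<longlonglongrightarrow> 0"
proof -
  obtain b where b: "0 < b" "\<And>u. N u \<le> b * norm u"
    using vector_norm_le_norm[OF norm] by blast
  obtain a where a: "0 < a" "\<And>u. a * norm u \<le> N u"
    using norm_le_vector_norm[OF norm] by blast
  define L where "L = M * b / a"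
  have L: "0 < L" using M a b by (simp add: L_def)
  have lip: "norm (g y - g z) \<le> L * norm (y - z)" for y z
  proof -
    have "a * norm (g y - g z) \<le> M * N (y - z)"
      using a(2) lipschitz order_trans by blast
    also have "\<dots> \<le> M * (b * norm (y - z))"
      using M b by simp
    finally show ?thesis using a(1) by (simp add: L_def field_simps)
  qed
  define E where "E = (SUP k. \<eta> k)"
  have E: "\<eta> k \<le> E" "E < 1" for k
  proof -
    have "bdd_above (range \<eta>)"
      using \<eta> by (intro bdd_aboveI[of _ 1]) (auto intro: less_imp_le)
    then show "\<eta> k \<le> E" unfolding E_def by (intro cSUP_upper) auto
    show "E < 1" using \<eta>_sup by (simp add: E_def)
  qed
  define C where "C = \<theta> * min 1 (\<beta> * ((1 - \<theta>) * lam / L)) * (lam / 2)"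
  define B where "B = b * (2 * Lam + 1 / \<tau>)"
  have C: "0 < C" using \<theta> \<beta> bounds L by (simp add: C_def)
  have B: "0 < B" using b bounds \<tau> by (simp add: B_def add_pos_pos)
  let ?F = "\<lambda>k. F_res \<mu> \<tau> g (x k)"
  let ?p = "\<lambda>k. phi \<mu> f (x k)"
  have decrease: "C * ((1 - E) * N (?F k) / B)\<^sup>2 \<le> ?p k - ?p (Suc k)" for k
  proof (cases "optimality_conditions \<mu> g (x k)")
    \<comment> \<open>Once the method has stopped, the iterate is repeated and both sides vanish.\<close>
    case True
    then have "?F k = 0" "x (Suc k) = x k"
      using F_res_eq_0_iff[OF \<mu> \<tau>(1)] iterates by (auto simp: isqa_iterates_def)
    then show ?thesis using norm by (simp add: vector_norm_zero)
  next
    case False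
    then have step: "isqa_step N \<mu> \<tau> \<theta> \<beta> (\<eta> k) f g (H k) (x k) (x (Suc k))"
      using iterates unfolding isqa_iterates_def by metis
    show ?thesis
      unfolding C_def B_def
      by (rule isqa_step_decrease[OF norm b \<mu> \<tau>(1) \<theta>(1) _ \<beta>(1) E _ L lip bounds(1) _ _ _ step])
        (use \<theta> gradient bounds eigenvalue_bounds in auto)
  qed
  have "(\<lambda>k. ?p k - ?p (Suc k)) \<longlonglongrightarrow> 0"
  proof (rule bounded_below_decrements_tendsto_0)
    obtain m where m: "\<And>y. m \<le> f y"
      using bounded_below by (auto simp: bdd_below_def)
    have "m \<le> ?p k" for k
      using m[of "x k"] \<mu> l1_norm_nonneg[of "x k"] by (simp add: phi_def add_increasing2)
    then show "bdd_below (range ?p)" by (intro bdd_belowI[of _ m]) auto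
    show "?p (Suc k) \<le> ?p k" for k
    proof -
      have "0 \<le> C * ((1 - E) * N (?F k) / B)\<^sup>2" using C by simp
      with decrease[of k] show ?thesis by linarith
    qed
  qed
  then have "(\<lambda>k. C * ((1 - E) * N (?F k) / B)\<^sup>2) \<longlonglongrightarrow> 0"
    by (rule tendsto_sandwich[OF _ _ tendsto_const, rotated 2])
      (use C decrease in \<open>auto intro!: always_eventually\<close>)
  then have "(\<lambda>k. (1 / C) * (C * ((1 - E) * N (?F k) / B)\<^sup>2)) \<longlonglongrightarrow> (1 / C) * 0"
    by (intro tendsto_mult_left)
  then have "(\<lambda>k. ((1 - E) * N (?F k) / B)\<^sup>2) \<longlonglongrightarrow> 0"
    using C by simp
  then have "(\<lambda>k. (1 - E) * N (?F k) / B) \<longlonglongrightarrow> 0"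
    by simp
  then have "(\<lambda>k. (B / ((1 - E) * a)) * ((1 - E) * N (?F k) / B)) \<longlonglongrightarrow> (B / ((1 - E) * a)) * 0"
    by (intro tendsto_mult_left)
  then have lim: "(\<lambda>k. N (?F k) / a) \<longlonglongrightarrow> 0"
    using B E(2) by simp
  show ?thesis
  proof (rule tendsto_norm_zero_cancel, rule tendsto_sandwich[OF _ _ tendsto_const lim])
    show "\<forall>\<^sub>F k in sequentially. norm (?F k) \<le> N (?F k) / a"
      using a by (intro always_eventually) (simp add: field_simps)
  qed simp
qed

end
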